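(* Let $(\Delta,G,\omega,\zeta)$ be a generalised voltage graph and let $\Gamma=\mathrm{GenCov}(\Delta,G,\omega,\zeta)$. Then $\Gamma$ is a simple graph if and only if for all darts $x\in D(\Delta)$ all of the following conditions hold: (1) $\zeta(x)h\zeta(x)^{-1} \notin \omega(\mathrm{end}_\Delta x)$ for all $h \in \omega(\mathrm{beg}_\Delta x) \setminus \omega(x)$; (2) $\zeta(y)h\zeta(x)^{-1} \notin \omega(\mathrm{end}_\Delta x)$ for all darts $y\ne x$ which are parallel to $x$ in $\Delta$ and for all $h\in \omega(\mathrm{beg}_\Delta x)$; (3) $\zeta(x)\notin \omega(x)$ if $x=x^{-1}$.
   Context: Graphs. A graph is a quadruple $(V,D,\mathrm{beg},\mathrm{inv})$ where $V$ is a non-empty set of vertices, $D$ is a set of darts (disjoint from $V$), $\mathrm{beg}\colon D\to V$, and $\mathrm{inv}\colon D\to D$ satisfies $\mathrm{inv}\,\mathrm{inv}\,x=x$ for all $x\in D$. For $\Gamma=(V,D,\mathrm{beg},\mathrm{inv})$ write $V(\Gamma)=V$, $D(\Gamma)=D$, $\mathrm{beg}_\Gamma=\mathrm{beg}$, $\mathrm{inv}_\Gamma=\mathrm{inv}$; also $x^{-1}:=\mathrm{inv}\,x$ and $\mathrm{end}_\Gamma x=\mathrm{end}\,x:=\mathrm{beg}\,x^{-1}$. Two darts $x,y$ are parallel if $\mathrm{beg}\,x=\mathrm{beg}\,y$ and $\mathrm{end}\,x=\mathrm{end}\,y$. An edge is a pair $\{x,x^{-1}\}$ with $x$ a dart,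 with endvertices $\mathrm{beg}\,x$ and $\mathrm{end}\,x$; it is a semi-edge if $x=x^{-1}$ and a loop if $x\neq x^{-1}$ but $\mathrm{beg}\,x=\mathrm{end}\,x$. Two distinct edges are parallel if they have the same endvertices. A graph is simple if it has no semi-edges, no loops and no pairs of distinct parallel edges. A graph is connected if any two vertices are joined by a walk, i.e. a sequence of darts $(x_1,\dots,x_n)$ with $\mathrm{end}\,x_i=\mathrm{beg}\,x_{i+1}$ (length $0$ allowed). Generalised voltage graphs. For a group $G$, $S(G)$ is the set of all subgroups of $G$, and $g^h:=h^{-1}gh$, $H^h:=h^{-1}Hh$. A generalised voltage graph is a quadruple $(\Delta,G,\omega,\zeta)$ where $\Delta$ is a connected graph, $G$ is a group, and $\omega\colon V(\Delta)\cup D(\Delta)\to S(G)$ and $\zeta\colon D(\Delta)\to G$ satisfy, for all $x\in D(\Delta)$: $\omega(x)\le\omega(\mathrm{beg}_\Delta x)$; $\omega(x)=\omega(x^{-1})^{\zeta(x)}$; and $\zeta(x^{-1})\zeta(x)\in\omega(x)$. Generalised cover. $\mathrm{GenCov}(\Delta,G,\omega,\zeta)$ is the graph $\Gamma$ with $V(\Gamma)=\{(v,\omega(v)g): v\in V(\Delta), g\in G\}$, $D(\Gamma)=\{(x,\omega(x)g): x\in D(\Delta), g\in G\}$, $\mathrm{beg}_\Gamma(x,\omega(x)g)=(\mathrm{beg}_\Delta x,\omega(\mathrm{beg}_\Delta x)g)$ and $\mathrm{inv}_\Gamma(x,\omega(x)g)=(x^{-1},\omega(x^{-1})\zeta(x)g)$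 (right cosets). *)

theory Defs
  imports "HOL-Algebra.Coset"
begin

(* Vertices and darts have separate types, so V and D are disjoint by typing. *)
record ('v, 'd) graph =
  verts :: "'v set"
  darts :: "'d set"
  beg :: "'d \<Rightarrow> 'v"
  dinv :: "'d \<Rightarrow> 'd"

definition end_of :: "('v, 'd, 'm) graph_scheme \<Rightarrow> 'd \<Rightarrow> 'v" where
  "end_of \<Gamma> x = beg \<Gamma> (dinv \<Gamma> x)"

locale graph =
  fixes \<Gamma> :: "('v, 'd, 'm) graph_scheme"
  assumes verts_nonempty: "verts \<Gamma> \<noteq> {}"
    and beg_closed: "beg \<Gamma> \<in> darts \<Gamma> \<rightarrow> verts \<Gamma>"
    and dinv_closed: "dinv \<Gamma> \<in> darts \<Gamma> \<rightarrow> darts \<Gamma>"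
    and dinv_dinv: "x \<in> darts \<Gamma> \<Longrightarrow> dinv \<Gamma> (dinv \<Gamma> x) = x"

definition parallel_darts :: "('v, 'd, 'm) graph_scheme \<Rightarrow> 'd \<Rightarrow> 'd \<Rightarrow> bool" where
  "parallel_darts \<Gamma> x y \<longleftrightarrow> beg \<Gamma> x = beg \<Gamma> y \<and> end_of \<Gamma> x = end_of \<Gamma> y"

definition edges :: "('v, 'd, 'm) graph_scheme \<Rightarrow> 'd set set" where
  "edges \<Gamma> = {{x, dinv \<Gamma> x} | x. x \<in> darts \<Gamma>}"

(* On the edge {x, dinv x} this is {beg x, end_of x}. *)
definition endverts :: "('v, 'd, 'm) graph_scheme \<Rightarrow> 'd set \<Rightarrow> 'v set" where
  "endverts \<Gamma> e = beg \<Gamma> ` e"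

definition semi_edge :: "('v, 'd, 'm) graph_scheme \<Rightarrow> 'd set \<Rightarrow> bool" where
  "semi_edge \<Gamma> e \<longleftrightarrow> (\<exists>x\<in>darts \<Gamma>. e = {x, dinv \<Gamma> x} \<and> x = dinv \<Gamma> x)"

definition loop_edge :: "('v, 'd, 'm) graph_scheme \<Rightarrow> 'd set \<Rightarrow> bool" where
  "loop_edge \<Gamma> e \<longleftrightarrow>
     (\<exists>x\<in>darts \<Gamma>. e = {x, dinv \<Gamma> x} \<and> x \<noteq> dinv \<Gamma> x \<and> beg \<Gamma> x = end_of \<Gamma> x)"

locale simple_graph = graph +
  assumes no_semi_edges: "e \<in> edges \<Gamma> \<Longrightarrow> \<not> semi_edge \<Gamma> e"
    and no_loops: "e \<in> edges \<Gamma> \<Longrightarrow> \<not> loop_edge \<Gamma> e"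
    and no_parallel_edges:
      "\<lbrakk>e \<in> edges \<Gamma>; f \<in> edges \<Gamma>; e \<noteq> f\<rbrakk> \<Longrightarrow> endverts \<Gamma> e \<noteq> endverts \<Gamma> f"

primrec walk :: "('v, 'd, 'm) graph_scheme \<Rightarrow> 'v \<Rightarrow> 'd list \<Rightarrow> 'v \<Rightarrow> bool" where
  "walk \<Gamma> u [] v \<longleftrightarrow> u = v"
| "walk \<Gamma> u (x # xs) v \<longleftrightarrow> x \<in> darts \<Gamma> \<and> beg \<Gamma> x = u \<and> walk \<Gamma> (end_of \<Gamma> x) xs v"

locale connected_graph = graph +
  assumes connected: "\<lbrakk>u \<in> verts \<Gamma>; v \<in> verts \<Gamma>\<rbrakk> \<Longrightarrow> \<exists>xs. walk \<Gamma> u xs v"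

definition conj_subset :: "('g, 'n) monoid_scheme \<Rightarrow> 'g set \<Rightarrow> 'g \<Rightarrow> 'g set" where
  "conj_subset G H h = {inv\<^bsub>G\<^esub> h \<otimes>\<^bsub>G\<^esub> k \<otimes>\<^bsub>G\<^esub> h | k. k \<in> H}"

(* The map omega is defined on the disjoint union of V and D: Inl v is a vertex, Inr x a dart. *)
locale gen_voltage_graph = connected_graph \<Delta> + group G
  for \<Delta> :: "('v, 'd, 'm) graph_scheme"
  and G :: "('g, 'n) monoid_scheme" (structure) +
  fixes \<omega> :: "'v + 'd \<Rightarrow> 'g set"
  and \<zeta> :: "'d \<Rightarrow> 'g"
  assumes omega_subgroup: "\<omega> \<in> verts \<Delta> <+> darts \<Delta> \<rightarrow> {H. subgroup H G}"
    and zeta_closed: "\<zeta> \<in> darts \<Delta> \<rightarrow> carrier G"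
    and omega_le: "x \<in> darts \<Delta> \<Longrightarrow> \<omega> (Inr x) \<subseteq> \<omega> (Inl (beg \<Delta> x))"
    and omega_conj: "x \<in> darts \<Delta> \<Longrightarrow>
      \<omega> (Inr x) = conj_subset G (\<omega> (Inr (dinv \<Delta> x))) (\<zeta> x)"
    and zeta_inv: "x \<in> darts \<Delta> \<Longrightarrow> \<zeta> (dinv \<Delta> x) \<otimes> \<zeta> x \<in> \<omega> (Inr x)"

(* The maps beg and dinv are given without choosing coset representatives, via products of
   subsets of G; GenCov_beg and GenCov_dinv below give their values on explicit cosets. *)
definition GenCov :: "('v, 'd, 'm) graph_scheme \<Rightarrow> ('g, 'n) monoid_scheme \<Rightarrow>
    ('v + 'd \<Rightarrow> 'g set) \<Rightarrow> ('d \<Rightarrow> 'g) \<Rightarrow> ('v \<times> 'g set, 'd \<times> 'g set) graph" where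
  "GenCov \<Delta> G \<omega> \<zeta> = \<lparr>
     verts = {(v, \<omega> (Inl v) #>\<^bsub>G\<^esub> g) | v g. v \<in> verts \<Delta> \<and> g \<in> carrier G},
     darts = {(x, \<omega> (Inr x) #>\<^bsub>G\<^esub> g) | x g. x \<in> darts \<Delta> \<and> g \<in> carrier G},
     beg = (\<lambda>(x, C). (beg \<Delta> x, \<omega> (Inl (beg \<Delta> x)) <#>\<^bsub>G\<^esub> C)),
     dinv = (\<lambda>(x, C). (dinv \<Delta> x, (\<omega> (Inr (dinv \<Delta> x)) #>\<^bsub>G\<^esub> \<zeta> x) <#>\<^bsub>G\<^esub> C)) \<rparr>"

context gen_voltage_graph
begin

lemma omega_vert: "v \<in> verts \<Delta> \<Longrightarrow> subgroup (\<omega> (Inl v)) G"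
  using omega_subgroup by blast

lemma omega_dart: "x \<in> darts \<Delta> \<Longrightarrow> subgroup (\<omega> (Inr x)) G"
  using omega_subgroup by blast

lemma GenCov_beg:
  assumes x: "x \<in> darts \<Delta>" and g: "g \<in> carrier G"
  shows "beg (GenCov \<Delta> G \<omega> \<zeta>) (x, \<omega> (Inr x) #> g) =
    (beg \<Delta> x, \<omega> (Inl (beg \<Delta> x)) #> g)"
proof -
  let ?H = "\<omega> (Inl (beg \<Delta> x))" and ?K = "\<omega> (Inr x)"
  have H: "subgroup ?H G" using x beg_closed omega_vert by blast
  have K: "subgroup ?K G" by (rule omega_dart[OF x])
  have HK: "?H <#> ?K = ?H"
  proof
    show "?H <#> ?K \<subseteq> ?H"
      using omega_le[OF x] subgroup.m_closed[OF H] unfolding set_mult_def by blast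
    show "?H \<subseteq> ?H <#> ?K"
    proof
      fix h assume h: "h \<in> ?H"
      then have "h = h \<otimes> \<one>" using subgroup.mem_carrier[OF H] by simp
      then show "h \<in> ?H <#> ?K"
        using h subgroup.one_closed[OF K] unfolding set_mult_def by blast
    qed
  qed
  have "?H <#> (?K #> g) = (?H <#> ?K) #> g"
    using setmult_rcos_assoc[OF subgroup.subset[OF H] subgroup.subset[OF K] g] by simp
  then show ?thesis unfolding HK by (simp add: GenCov_def)
qed

lemma GenCov_dinv:
  assumes x: "x \<in> darts \<Delta>" and g: "g \<in> carrier G"
  shows "dinv (GenCov \<Delta> G \<omega> \<zeta>) (x, \<omega> (Inr x) #> g) =
    (dinv \<Delta> x, \<omega> (Inr (dinv \<Delta> x)) #> (\<zeta> x \<otimes> g))"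
proof -
  let ?H = "\<omega> (Inr (dinv \<Delta> x))" and ?K = "\<omega> (Inr x)" and ?z = "\<zeta> x"
  have H: "subgroup ?H G" using x dinv_closed omega_dart by blast
  have K: "subgroup ?K G" by (rule omega_dart[OF x])
  have z: "?z \<in> carrier G" using x zeta_closed by blast
  note Hc = subgroup.mem_carrier[OF H]
  have "(?H #> ?z) <#> ?K = ?H #> ?z"
  proof
    show "(?H #> ?z) <#> ?K \<subseteq> ?H #> ?z"
    proof
      fix a assume "a \<in> (?H #> ?z) <#> ?K"
      then obtain h k' where h: "h \<in> ?H" and k': "k' \<in> ?K" and a': "a = (h \<otimes> ?z) \<otimes> k'"
        unfolding set_mult_def r_coset_def by blast
      from k' have "k' \<in> conj_subset G ?H ?z" by (simp only: omega_conj[OF x, symmetric])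
      then obtain k where k: "k \<in> ?H" and "k' = inv ?z \<otimes> k \<otimes> ?z"
        unfolding conj_subset_def by blast
      with a' have a: "a = (h \<otimes> ?z) \<otimes> (inv ?z \<otimes> k \<otimes> ?z)" by simp
      have "?z \<otimes> (inv ?z \<otimes> k \<otimes> ?z) = k \<otimes> ?z"
        using z Hc[OF k] by (simp add: m_assoc[symmetric])
      then have "a = (h \<otimes> k) \<otimes> ?z"
        unfolding a using z Hc[OF h] Hc[OF k] by (simp add: m_assoc)
      then show "a \<in> ?H #> ?z"
        using subgroup.m_closed[OF H h k] unfolding r_coset_def by blast
    qed
    show "?H #> ?z \<subseteq> (?H #> ?z) <#> ?K"
    proof
      fix a assume a: "a \<in> ?H #> ?z"
      have "a \<in> carrier G"
        using r_coset_subset_G[OF subgroup.subset[OF H] z] a by (rule subsetD)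
      then have "a = a \<otimes> \<one>" by simp
      then show "a \<in> (?H #> ?z) <#> ?K"
        using a subgroup.one_closed[OF K] unfolding set_mult_def by blast
    qed
  qed
  moreover have "(?H #> ?z) <#> (?K #> g) = ((?H #> ?z) <#> ?K) #> g"
    using setmult_rcos_assoc[OF r_coset_subset_G[OF subgroup.subset[OF H] z]
        subgroup.subset[OF K] g] by simp
  moreover have "(?H #> ?z) #> g = ?H #> (?z \<otimes> g)"
    by (rule coset_mult_assoc[OF subgroup.subset[OF H] z g])
  ultimately show ?thesis by (simp add: GenCov_def)
qed

lemma GenCov_graph: "graph (GenCov \<Delta> G \<omega> \<zeta>)" (is "graph ?\<Gamma>")
proof
  have V: "verts ?\<Gamma> = {(v, \<omega> (Inl v) #> g) | v g. v \<in> verts \<Delta> \<and> g \<in> carrier G}"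
    and D: "darts ?\<Gamma> = {(x, \<omega> (Inr x) #> g) | x g. x \<in> darts \<Delta> \<and> g \<in> carrier G}"
    by (simp_all add: GenCov_def)
  show "verts ?\<Gamma> \<noteq> {}"
    unfolding V using verts_nonempty one_closed by blast
  show "beg ?\<Gamma> \<in> darts ?\<Gamma> \<rightarrow> verts ?\<Gamma>"
  proof
    fix X assume "X \<in> darts ?\<Gamma>"
    then obtain x g where X: "X = (x, \<omega> (Inr x) #> g)"
      and x: "x \<in> darts \<Delta>" and g: "g \<in> carrier G" unfolding D by blast
    have "beg \<Delta> x \<in> verts \<Delta>" using x beg_closed by blast
    then show "beg ?\<Gamma> X \<in> verts ?\<Gamma>"
      unfolding X GenCov_beg[OF x g] V using g by blast
  qed
  show "dinv ?\<Gamma> \<in> darts ?\<Gamma> \<rightarrow> darts ?\<Gamma>"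
  proof
    fix X assume "X \<in> darts ?\<Gamma>"
    then obtain x g where X: "X = (x, \<omega> (Inr x) #> g)"
      and x: "x \<in> darts \<Delta>" and g: "g \<in> carrier G" unfolding D by blast
    have "\<zeta> x \<otimes> g \<in> carrier G" "dinv \<Delta> x \<in> darts \<Delta>"
      using x g zeta_closed dinv_closed by blast+
    then show "dinv ?\<Gamma> X \<in> darts ?\<Gamma>"
      unfolding X GenCov_dinv[OF x g] D by blast
  qed
  fix X assume "X \<in> darts ?\<Gamma>"
  then obtain x g where X: "X = (x, \<omega> (Inr x) #> g)"
    and x: "x \<in> darts \<Delta>" and g: "g \<in> carrier G" unfolding D by blast
  have y: "dinv \<Delta> x \<in> darts \<Delta>" using x dinv_closed by blast
  have z: "\<zeta> x \<in> carrier G" "\<zeta> (dinv \<Delta> x) \<in> carrier G" using x y zeta_closed by blast+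
  have K: "subgroup (\<omega> (Inr x)) G" by (rule omega_dart[OF x])
  have "\<omega> (Inr x) #> (\<zeta> (dinv \<Delta> x) \<otimes> (\<zeta> x \<otimes> g)) =
      \<omega> (Inr x) #> (\<zeta> (dinv \<Delta> x) \<otimes> \<zeta> x) #> g"
    using z g subgroup.subset[OF K] by (simp add: coset_mult_assoc m_assoc)
  also have "\<omega> (Inr x) #> (\<zeta> (dinv \<Delta> x) \<otimes> \<zeta> x) = \<omega> (Inr x)"
    using z zeta_inv[OF x] by (intro coset_join2 K) auto
  finally show "dinv ?\<Gamma> (dinv ?\<Gamma> X) = X"
    using z g unfolding X by (simp add: GenCov_dinv x y dinv_dinv)
qed

end

end

theory Submission
  imports Defs
begin

text \<open>A graph is simple iff it has no self-inverse dart and parallel darts are equal. In the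
  generalised cover, two darts above \<open>x\<close> and \<open>y\<close> with the same initial vertex can be written
  \<open>(x, \<omega>(x)g)\<close> and \<open>(y, \<omega>(y)hg)\<close> with \<open>h \<in> \<omega>(beg x)\<close>, and their terminal vertices agree iff
  \<open>\<zeta>(y)h\<zeta>(x)\<inverse> \<in> \<omega>(end x)\<close>. The cases \<open>x = y\<close> and \<open>x \<noteq> y\<close> give conditions (1) and (2), while
  (3) excludes self-inverse darts.\<close>

text \<open>A semi-edge is a self-inverse dart, a loop at \<open>x\<close> makes \<open>x\<close>
  parallel to its inverse, and two edges with the same endvertices carry parallel darts once one of
  them is suitably reversed. Conversely, distinct parallel darts either lie on two distinct parallel
  edges or are mutually inverse and form a loop.\<close>

lemma (in graph) simple_graph_iff_darts:
  "simple_graph \<Gamma> \<longleftrightarrow>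
    (\<forall>x\<in>darts \<Gamma>. dinv \<Gamma> x \<noteq> x) \<and>
    (\<forall>x\<in>darts \<Gamma>. \<forall>y\<in>darts \<Gamma>. parallel_darts \<Gamma> x y \<longrightarrow> x = y)"
  (is "_ \<longleftrightarrow> ?semi \<and> ?par")
proof
  assume "simple_graph \<Gamma>"
  then interpret simple_graph \<Gamma> .
  have semi: ?semi
  proof (intro ballI notI)
    fix x assume x: "x \<in> darts \<Gamma>" and "dinv \<Gamma> x = x"
    then have "semi_edge \<Gamma> {x, dinv \<Gamma> x}"
      unfolding semi_edge_def by metis
    moreover have "{x, dinv \<Gamma> x} \<in> edges \<Gamma>" using x unfolding edges_def by blast
    ultimately show False using no_semi_edges by blast
  qed
  moreover have ?par
  proof (intro ballI impI, rule ccontr)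
    fix x y assume x: "x \<in> darts \<Gamma>" and y: "y \<in> darts \<Gamma>"
      and p: "parallel_darts \<Gamma> x y" and ne: "x \<noteq> y"
    have ex: "{x, dinv \<Gamma> x} \<in> edges \<Gamma>" and ey: "{y, dinv \<Gamma> y} \<in> edges \<Gamma>"
      using x y unfolding edges_def by blast+
    have "endverts \<Gamma> {x, dinv \<Gamma> x} = endverts \<Gamma> {y, dinv \<Gamma> y}"
      using p unfolding endverts_def parallel_darts_def end_of_def by simp
    with no_parallel_edges[OF ex ey] have "{x, dinv \<Gamma> x} = {y, dinv \<Gamma> y}" by blast
    \<comment> \<open>Two distinct darts on one edge are mutually inverse. Being parallel as well,
      they begin and end at the same vertex; this is a loop rather than a semi-edge because
      self-inverse darts are already excluded.\<close>
    with ne have "y = dinv \<Gamma> x" by (auto simp: doubleton_eq_iff)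
    then have "beg \<Gamma> x = end_of \<Gamma> x"
      using p unfolding parallel_darts_def end_of_def by simp
    moreover have "x \<noteq> dinv \<Gamma> x" using semi x by metis
    ultimately have "loop_edge \<Gamma> {x, dinv \<Gamma> x}"
      unfolding loop_edge_def using x by blast
    with no_loops[OF ex] show False by blast
  qed
  ultimately show "?semi \<and> ?par" ..
next
  assume "?semi \<and> ?par"
  then have semi: ?semi and par: ?par by blast+
  show "simple_graph \<Gamma>"
  proof
    fix e show "\<not> semi_edge \<Gamma> e" using semi unfolding semi_edge_def by metis
  next
    fix e show "\<not> loop_edge \<Gamma> e"
    proof
      assume "loop_edge \<Gamma> e"
      then obtain x where x: "x \<in> darts \<Gamma>" "x \<noteq> dinv \<Gamma> x" "beg \<Gamma> x = end_of \<Gamma> x"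
        unfolding loop_edge_def by blast
      then have "parallel_darts \<Gamma> x (dinv \<Gamma> x)" "dinv \<Gamma> x \<in> darts \<Gamma>"
        using dinv_dinv dinv_closed unfolding parallel_darts_def end_of_def by auto
      with par x show False by blast
    qed
  next
    fix e f assume "e \<in> edges \<Gamma>" "f \<in> edges \<Gamma>" and ne: "e \<noteq> f"
    then obtain x y where x: "x \<in> darts \<Gamma>" and e: "e = {x, dinv \<Gamma> x}"
      and y: "y \<in> darts \<Gamma>" and f: "f = {y, dinv \<Gamma> y}"
      unfolding edges_def by blast
    have y': "dinv \<Gamma> y \<in> darts \<Gamma>" using y dinv_closed by blast
    have yy: "dinv \<Gamma> (dinv \<Gamma> y) = y" by (rule dinv_dinv[OF y])
    show "endverts \<Gamma> e \<noteq> endverts \<Gamma> f"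
    proof
      assume "endverts \<Gamma> e = endverts \<Gamma> f"
      then have "{beg \<Gamma> x, end_of \<Gamma> x} = {beg \<Gamma> y, end_of \<Gamma> y}"
        unfolding e f endverts_def end_of_def by simp
      \<comment> \<open>Endvertices form an unordered pair. If they match crosswise, reversing
        \<open>y\<close> makes the darts parallel, which does not change the edge
        \<open>f\<close>.\<close>
      then have "parallel_darts \<Gamma> x y \<or> parallel_darts \<Gamma> x (dinv \<Gamma> y)"
        unfolding parallel_darts_def end_of_def yy by (auto simp: doubleton_eq_iff)
      then have "x = y \<or> x = dinv \<Gamma> y" using par x y y' by blast
      then have "e = f" unfolding e f using yy by auto
      with ne show False ..
    qed
  qed
qed

text \<open>Right cosets of \<open>H\<close> coincide as soon as they share an element, here
  \<open>b\<close>. Putting \<open>b\<close> first in the quotient produces products of the shape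
  \<open>\<zeta> y \<otimes> h \<otimes> inv (\<zeta> x)\<close> when terminal vertices are
  compared.\<close>

lemma (in group) rcos_eq_iff:
  assumes H: "subgroup H G" and a: "a \<in> carrier G" and b: "b \<in> carrier G"
  shows "H #> a = H #> b \<longleftrightarrow> b \<otimes> inv a \<in> H"
proof
  assume "H #> a = H #> b"
  then have "b \<in> H #> a" using rcos_self[OF b H] by simp
  then obtain h where h: "h \<in> H" "b = h \<otimes> a" unfolding r_coset_def by blast
  then have "b \<otimes> inv a = h"
    using a subgroup.mem_carrier[OF H] by (simp add: m_assoc)
  with h show "b \<otimes> inv a \<in> H" by simp
next
  assume h: "b \<otimes> inv a \<in> H"
  have "b = (b \<otimes> inv a) \<otimes> a" using a b by (simp add: m_assoc)
  with h have "b \<in> H #> a" unfolding r_coset_def by blast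
  then show "H #> a = H #> b" by (rule repr_independence[OF _ a H])
qed

context gen_voltage_graph
begin

lemma zeta_in: "x \<in> darts \<Delta> \<Longrightarrow> \<zeta> x \<in> carrier G"
  using zeta_closed by blast

lemma omega_beg: "x \<in> darts \<Delta> \<Longrightarrow> subgroup (\<omega> (Inl (beg \<Delta> x))) G"
  using beg_closed omega_vert by blast

lemma omega_end: "x \<in> darts \<Delta> \<Longrightarrow> subgroup (\<omega> (Inl (end_of \<Delta> x))) G"
  using dinv_closed omega_beg unfolding end_of_def by blast

lemma ball_darts_GenCov:
  "(\<forall>X\<in>darts (GenCov \<Delta> G \<omega> \<zeta>). P X) \<longleftrightarrow>
    (\<forall>x\<in>darts \<Delta>. \<forall>g\<in>carrier G. P (x, \<omega> (Inr x) #> g))"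
  unfolding GenCov_def by auto

lemma GenCov_end_of:
  assumes x: "x \<in> darts \<Delta>" and g: "g \<in> carrier G"
  shows "end_of (GenCov \<Delta> G \<omega> \<zeta>) (x, \<omega> (Inr x) #> g) =
    (end_of \<Delta> x, \<omega> (Inl (end_of \<Delta> x)) #> (\<zeta> x \<otimes> g))"
proof -
  have "dinv \<Delta> x \<in> darts \<Delta>" using x dinv_closed by blast
  then show ?thesis
    using zeta_in[OF x] g unfolding end_of_def by (simp add: GenCov_dinv x GenCov_beg)
qed

text \<open>Inversion replaces the representative \<open>g\<close> by
  \<open>\<zeta> x \<otimes> g\<close>. The quotient of the two is \<open>\<zeta> x\<close>, so
  \<open>g\<close> cancels and the whole fibre over \<open>x\<close> behaves alike.\<close>

lemma GenCov_dinv_fixed_iff: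
  assumes x: "x \<in> darts \<Delta>" and g: "g \<in> carrier G"
  shows "dinv (GenCov \<Delta> G \<omega> \<zeta>) (x, \<omega> (Inr x) #> g) = (x, \<omega> (Inr x) #> g) \<longleftrightarrow>
    x = dinv \<Delta> x \<and> \<zeta> x \<in> \<omega> (Inr x)"
proof (cases "dinv \<Delta> x = x")
  case True
  have "\<omega> (Inr x) #> g = \<omega> (Inr x) #> (\<zeta> x \<otimes> g) \<longleftrightarrow> \<zeta> x \<in> \<omega> (Inr x)"
    using rcos_eq_iff[OF omega_dart[OF x] g, of "\<zeta> x \<otimes> g"] g zeta_in[OF x]
    by (simp add: m_assoc)
  then show ?thesis unfolding GenCov_dinv[OF x g] True by auto
next
  case False
  then show ?thesis unfolding GenCov_dinv[OF x g] by auto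
qed

text \<open>The initial vertices have representatives \<open>g\<close> and \<open>k\<close>, the
  terminal ones \<open>\<zeta> x \<otimes> g\<close> and \<open>\<zeta> y \<otimes> k\<close>. Both
  quotients depend on \<open>g\<close> and \<open>k\<close> only through
  \<open>k \<otimes> inv g\<close>.\<close>

lemma GenCov_parallel_iff:
  assumes x: "x \<in> darts \<Delta>" and y: "y \<in> darts \<Delta>"
    and g: "g \<in> carrier G" and k: "k \<in> carrier G"
  shows "parallel_darts (GenCov \<Delta> G \<omega> \<zeta>) (x, \<omega> (Inr x) #> g) (y, \<omega> (Inr y) #> k) \<longleftrightarrow>
    parallel_darts \<Delta> x y \<and> k \<otimes> inv g \<in> \<omega> (Inl (beg \<Delta> x)) \<and>
    \<zeta> y \<otimes> (k \<otimes> inv g) \<otimes> inv (\<zeta> x) \<in> \<omega> (Inl (end_of \<Delta> x))"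
proof -
  have z: "\<zeta> x \<in> carrier G" "\<zeta> y \<in> carrier G" using x y zeta_in by blast+
  have "(\<zeta> y \<otimes> k) \<otimes> inv (\<zeta> x \<otimes> g) = \<zeta> y \<otimes> (k \<otimes> inv g) \<otimes> inv (\<zeta> x)"
    using z g k by (simp add: m_assoc inv_mult_group)
  then have "\<omega> (Inl (end_of \<Delta> x)) #> (\<zeta> x \<otimes> g) = \<omega> (Inl (end_of \<Delta> x)) #> (\<zeta> y \<otimes> k) \<longleftrightarrow>
      \<zeta> y \<otimes> (k \<otimes> inv g) \<otimes> inv (\<zeta> x) \<in> \<omega> (Inl (end_of \<Delta> x))"
    using rcos_eq_iff[OF omega_end[OF x], of "\<zeta> x \<otimes> g" "\<zeta> y \<otimes> k"] z g k by simp
  with rcos_eq_iff[OF omega_beg[OF x] g k] show ?thesis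
    unfolding parallel_darts_def GenCov_beg[OF x g] GenCov_beg[OF y k]
      GenCov_end_of[OF x g] GenCov_end_of[OF y k] by auto
qed

lemma GenCov_dart_eq_iff:
  assumes x: "x \<in> darts \<Delta>" and g: "g \<in> carrier G" and k: "k \<in> carrier G"
  shows "(x, \<omega> (Inr x) #> g) = (y, \<omega> (Inr y) #> k) \<longleftrightarrow> x = y \<and> k \<otimes> inv g \<in> \<omega> (Inr x)"
  using rcos_eq_iff[OF omega_dart[OF x] g k] by auto

text \<open>Parallelism and equality of the two cover darts are both conditions on
  \<open>h = k \<otimes> inv g\<close>, so the two representatives can be traded for a single group
  element.\<close>

lemma GenCov_parallel_eq_iff:
  assumes x: "x \<in> darts \<Delta>" and y: "y \<in> darts \<Delta>"
  shows "(\<forall>g\<in>carrier G. \<forall>k\<in>carrier G.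
      parallel_darts (GenCov \<Delta> G \<omega> \<zeta>) (x, \<omega> (Inr x) #> g) (y, \<omega> (Inr y) #> k) \<longrightarrow>
      (x, \<omega> (Inr x) #> g) = (y, \<omega> (Inr y) #> k)) \<longleftrightarrow>
    (\<forall>h\<in>\<omega> (Inl (beg \<Delta> x)). parallel_darts \<Delta> x y \<and>
      \<zeta> y \<otimes> h \<otimes> inv (\<zeta> x) \<in> \<omega> (Inl (end_of \<Delta> x)) \<longrightarrow> x = y \<and> h \<in> \<omega> (Inr x))"
  (is "?L \<longleftrightarrow> ?R")
proof
  assume L: ?L
  show ?R
  proof (intro ballI impI)
    fix h assume h: "h \<in> \<omega> (Inl (beg \<Delta> x))" and p: "parallel_darts \<Delta> x y \<and>
      \<zeta> y \<otimes> h \<otimes> inv (\<zeta> x) \<in> \<omega> (Inl (end_of \<Delta> x))"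
    have hc: "h \<in> carrier G" using subgroup.mem_carrier[OF omega_beg[OF x] h] .
    \<comment> \<open>The representatives \<open>\<one>\<close> and \<open>h\<close> realise the
      prescribed quotient \<open>h\<close>.\<close>
    have "parallel_darts (GenCov \<Delta> G \<omega> \<zeta>) (x, \<omega> (Inr x) #> \<one>) (y, \<omega> (Inr y) #> h)"
      using h p hc by (simp add: GenCov_parallel_iff[OF x y one_closed hc])
    with L hc have "(x, \<omega> (Inr x) #> \<one>) = (y, \<omega> (Inr y) #> h)" by blast
    then show "x = y \<and> h \<in> \<omega> (Inr x)"
      unfolding GenCov_dart_eq_iff[OF x one_closed hc] using hc by auto
  qed
next
  assume R: ?R
  show ?L
  proof (intro ballI impI)
    fix g k assume g: "g \<in> carrier G" and k: "k \<in> carrier G"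
      and "parallel_darts (GenCov \<Delta> G \<omega> \<zeta>) (x, \<omega> (Inr x) #> g) (y, \<omega> (Inr y) #> k)"
    with R show "(x, \<omega> (Inr x) #> g) = (y, \<omega> (Inr y) #> k)"
      unfolding GenCov_parallel_iff[OF x y g k] GenCov_dart_eq_iff[OF x g k] by blast
  qed
qed

end

theorem theorem37:
  fixes \<Delta> :: "('v, 'd) graph" and G :: "'g monoid" (structure)
    and \<omega> :: "'v + 'd \<Rightarrow> 'g set" and \<zeta> :: "'d \<Rightarrow> 'g"
  assumes "gen_voltage_graph \<Delta> G \<omega> \<zeta>"
  shows "simple_graph (GenCov \<Delta> G \<omega> \<zeta>) \<longleftrightarrow>
    (\<forall>x\<in>darts \<Delta>.
      (\<forall>h\<in>\<omega> (Inl (beg \<Delta> x)) - \<omega> (Inr x).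
         \<zeta> x \<otimes> h \<otimes> inv (\<zeta> x) \<notin> \<omega> (Inl (end_of \<Delta> x))) \<and>
      (\<forall>y\<in>darts \<Delta>. y \<noteq> x \<and> parallel_darts \<Delta> y x \<longrightarrow>
         (\<forall>h\<in>\<omega> (Inl (beg \<Delta> x)). \<zeta> y \<otimes> h \<otimes> inv (\<zeta> x) \<notin> \<omega> (Inl (end_of \<Delta> x)))) \<and>
      (x = dinv \<Delta> x \<longrightarrow> \<zeta> x \<notin> \<omega> (Inr x)))"
proof -
  interpret gen_voltage_graph \<Delta> G \<omega> \<zeta> by (rule assms)
  interpret cover: graph "GenCov \<Delta> G \<omega> \<zeta>" by (rule GenCov_graph)
  have simple: "simple_graph (GenCov \<Delta> G \<omega> \<zeta>) \<longleftrightarrow>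
    (\<forall>x\<in>darts \<Delta>. x = dinv \<Delta> x \<longrightarrow> \<zeta> x \<notin> \<omega> (Inr x)) \<and>
    (\<forall>x\<in>darts \<Delta>. \<forall>y\<in>darts \<Delta>. \<forall>h\<in>\<omega> (Inl (beg \<Delta> x)). parallel_darts \<Delta> x y \<and>
      \<zeta> y \<otimes> h \<otimes> inv (\<zeta> x) \<in> \<omega> (Inl (end_of \<Delta> x)) \<longrightarrow> x = y \<and> h \<in> \<omega> (Inr x))"
    (is "_ \<longleftrightarrow> ?semi \<and> ?par")
  proof -
    \<comment> \<open>The condition for a fixed dart does not involve \<open>g\<close>;
      \<open>one_closed\<close> provides a dart over each \<open>x\<close>, so the quantifier over
      \<open>g\<close> is not vacuous.\<close>
    have "(\<forall>X\<in>darts (GenCov \<Delta> G \<omega> \<zeta>). dinv (GenCov \<Delta> G \<omega> \<zeta>) X \<noteq> X) \<longleftrightarrow> ?semi"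
      unfolding ball_darts_GenCov using one_closed by (auto simp: GenCov_dinv_fixed_iff)
    moreover have "(\<forall>X\<in>darts (GenCov \<Delta> G \<omega> \<zeta>). \<forall>Y\<in>darts (GenCov \<Delta> G \<omega> \<zeta>).
        parallel_darts (GenCov \<Delta> G \<omega> \<zeta>) X Y \<longrightarrow> X = Y) \<longleftrightarrow> ?par"
      (is "?lhs \<longleftrightarrow> _")
    proof -
      have "?lhs \<longleftrightarrow> (\<forall>x\<in>darts \<Delta>. \<forall>y\<in>darts \<Delta>. \<forall>g\<in>carrier G. \<forall>k\<in>carrier G.
        parallel_darts (GenCov \<Delta> G \<omega> \<zeta>) (x, \<omega> (Inr x) #> g) (y, \<omega> (Inr y) #> k) \<longrightarrow>
        (x, \<omega> (Inr x) #> g) = (y, \<omega> (Inr y) #> k))"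
        unfolding ball_darts_GenCov by blast
      also have "\<dots> \<longleftrightarrow> ?par"
        by (intro ball_cong refl GenCov_parallel_eq_iff)
      finally show ?thesis .
    qed
    ultimately show ?thesis unfolding cover.simple_graph_iff_darts by simp
  qed
  \<comment> \<open>Split on whether \<open>y\<close> equals \<open>x\<close>. For
    \<open>y = x\<close> the implication is the contrapositive of condition (1); for
    \<open>y \<noteq> x\<close> its conclusion is false, so its premise must fail, which is
    condition (2).\<close>
  have par: "(\<forall>y\<in>darts \<Delta>. \<forall>h\<in>\<omega> (Inl (beg \<Delta> x)). parallel_darts \<Delta> x y \<and>
      \<zeta> y \<otimes> h \<otimes> inv (\<zeta> x) \<in> \<omega> (Inl (end_of \<Delta> x)) \<longrightarrow> x = y \<and> h \<in> \<omega> (Inr x)) \<longleftrightarrow>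
    (\<forall>h\<in>\<omega> (Inl (beg \<Delta> x)) - \<omega> (Inr x).
      \<zeta> x \<otimes> h \<otimes> inv (\<zeta> x) \<notin> \<omega> (Inl (end_of \<Delta> x))) \<and>
    (\<forall>y\<in>darts \<Delta>. y \<noteq> x \<and> parallel_darts \<Delta> y x \<longrightarrow>
      (\<forall>h\<in>\<omega> (Inl (beg \<Delta> x)). \<zeta> y \<otimes> h \<otimes> inv (\<zeta> x) \<notin> \<omega> (Inl (end_of \<Delta> x))))"
    (is "?A x \<longleftrightarrow> ?B x") if x: "x \<in> darts \<Delta>" for x
  proof -
    have refl: "parallel_darts \<Delta> x x"
      and sym: "parallel_darts \<Delta> y z \<Longrightarrow> parallel_darts \<Delta> z y" for y z
      unfolding parallel_darts_def by auto
    show ?thesis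
    proof
      assume "?A x"
      then show "?B x" using x refl sym by blast
    next
      assume r: "?B x"
      show "?A x"
      proof (intro ballI impI)
        fix y h assume y: "y \<in> darts \<Delta>" and h: "h \<in> \<omega> (Inl (beg \<Delta> x))"
          and p: "parallel_darts \<Delta> x y \<and> \<zeta> y \<otimes> h \<otimes> inv (\<zeta> x) \<in> \<omega> (Inl (end_of \<Delta> x))"
        \<comment> \<open>Condition (2) rules out \<open>y \<noteq> x\<close>; then condition (1)
          leaves no room for \<open>h\<close> outside \<open>\<omega> (Inr x)\<close>.\<close>
        have "parallel_darts \<Delta> y x" using p sym by blast
        with r y h p have "y = x" by blast
        with r h p show "x = y \<and> h \<in> \<omega> (Inr x)" by blast
      qed
    qed
  qed
  have "simple_graph (GenCov \<Delta> G \<omega> \<zeta>) \<longleftrightarrow>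
    (\<forall>x\<in>darts \<Delta>. x = dinv \<Delta> x \<longrightarrow> \<zeta> x \<notin> \<omega> (Inr x)) \<and> (\<forall>x\<in>darts \<Delta>. ?B x)"
    by (subst simple, intro arg_cong2[where f = "(\<and>)"] refl ball_cong par)
  then show ?thesis by (simp only: ball_conj_distrib conj_ac)
qed

end
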